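(* Let $\mathcal{H}$ be a real Hilbert space, $J\in\mathcal{C}$, and let $u$ solve the gradient flow of $J$ with initial datum $f$. If there is $C>0$ such that $$\|u(t)-\bar f\|\le C\,J(u(t))\quad\forall t>0,$$ then it holds $$T^*(f)\le C\|f-\bar f\|.$$
   Context: The class $\mathcal{C}$ consists of all maps $J:\mathcal{H}\to\mathbb{R}\cup\{+\infty\}$ that are convex, lower semicontinuous with respect to the strong topology of $\mathcal{H}$, and absolutely one-homogeneous, i.e. $J(cu)=|c|J(u)$ for all $u\in\mathcal{H}$, $c\in\mathbb{R}\setminus\{0\}$, and $J(0)=0$. The subdifferential is $\partial J(u)=\{p\in\mathcal{H}:\langle p,v\rangle\le J(v)\ \forall v\in\mathcal{H},\ \langle p,u\rangle=J(u)\}$, and $\mathrm{dom}(\partial J)=\{u:\partial J(u)\ne\emptyset\}$. $\bar f$ is the orthogonal projection of $f$ onto the closed linear space $\mathcal{N}(J)=\{u:J(u)=0\}$. The extinction time is $T^*(f):=\inf\{t>0:u(t)=\bar f\}$ (with $\inf\emptyset=+\infty$). Gradient flow: for $f\in\overline{\mathrm{dom}(\partial J)}$, the solution $(u,p)$ of $\partial_tu(t)=-p(t)$, $p(t)\in\partial J(u(t))$, $u(0)=f$ is the unique continuous $u:[0,\infty)\to\mathcal{H}$ with $u(0)=f$ given by Brezis' theory (Lipschitz on $[\delta,\infty)$ for every $\delta>0$, $u(t)\in\mathrm{dom}(\partial J)$ for all $t>0$, right-differentiable at every $t>0$), together with $p(t):=-\partial_t^+u(t)$, which is the element of minimal norm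 in $\partial J(u(t))$ for every $t>0$. *)

theory Defs
  imports "HOL-Analysis.Analysis"
begin

definition convex_ereal :: "('a::real_vector \<Rightarrow> ereal) \<Rightarrow> bool" where
  "convex_ereal J \<longleftrightarrow>
     (\<forall>u v. \<forall>s\<in>{0..1::real}.
        J ((1 - s) *\<^sub>R u + s *\<^sub>R v) \<le> ereal (1 - s) * J u + ereal s * J v)"

definition lower_semicontinuous :: "('a::topological_space \<Rightarrow> ereal) \<Rightarrow> bool" where
  "lower_semicontinuous J \<longleftrightarrow> (\<forall>u. J u \<le> Liminf (at u) J)"

definition absolutely_one_homogeneous :: "('a::real_vector \<Rightarrow> ereal) \<Rightarrow> bool" where
  "absolutely_one_homogeneous J \<longleftrightarrow>
     (\<forall>u. \<forall>c::real. c \<noteq> 0 \<longrightarrow> J (c *\<^sub>R u) = ereal \<bar>c\<bar> * J u) \<and> J 0 = 0"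

text \<open>The class of functionals with values in the reals extended by plus infinity;
  the value minus infinity of \<^typ>\<open>ereal\<close> is excluded explicitly.\<close>

definition class_C :: "('a::{real_inner, complete_space} \<Rightarrow> ereal) set" where
  "class_C = {J. (\<forall>u. J u \<noteq> -\<infinity>) \<and> convex_ereal J \<and> lower_semicontinuous J \<and>
                 absolutely_one_homogeneous J}"

definition subdifferential :: "('a::real_inner \<Rightarrow> ereal) \<Rightarrow> 'a \<Rightarrow> 'a set" where
  "subdifferential J u = {p. (\<forall>v. ereal (p \<bullet> v) \<le> J v) \<and> ereal (p \<bullet> u) = J u}"

definition dom_subdifferential :: "('a::real_inner \<Rightarrow> ereal) \<Rightarrow> 'a set" where
  "dom_subdifferential J = {u. subdifferential J u \<noteq> {}}"

definition null_set :: "('a \<Rightarrow> ereal) \<Rightarrow> 'a set" where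
  "null_set J = {u. J u = 0}"

text \<open>Orthogonal projection onto a closed linear subspace; existence and uniqueness
  for \<^term>\<open>null_set J\<close> are shown in \<open>proj_null_set\<close> below.\<close>

definition orthogonal_projection :: "'a::real_inner set \<Rightarrow> 'a \<Rightarrow> 'a" where
  "orthogonal_projection S f = (THE x. x \<in> S \<and> (\<forall>y\<in>S. orthogonal (f - x) y))"

definition proj_null :: "('a::real_inner \<Rightarrow> ereal) \<Rightarrow> 'a \<Rightarrow> 'a" where
  "proj_null J f = orthogonal_projection (null_set J) f"

text \<open>The pair \<open>(u, p)\<close> is the solution of the gradient flow in the sense of Brezis.
  Only the values \<open>u t\<close> for \<open>t \<ge> 0\<close> and \<open>p t\<close> for \<open>t > 0\<close> matter.
  The derivative along \<^term>\<open>at_right t\<close> is the right derivative.\<close>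

definition gradient_flow ::
  "('a::real_inner \<Rightarrow> ereal) \<Rightarrow> 'a \<Rightarrow> (real \<Rightarrow> 'a) \<Rightarrow> (real \<Rightarrow> 'a) \<Rightarrow> bool" where
  "gradient_flow J f u p \<longleftrightarrow>
     f \<in> closure (dom_subdifferential J) \<and>
     continuous_on {0..} u \<and> u 0 = f \<and>
     (\<forall>\<delta>>0. \<exists>L. L-lipschitz_on {\<delta>..} u) \<and>
     (\<forall>t>0. u t \<in> dom_subdifferential J) \<and>
     (\<forall>t>0. (u has_vector_derivative - p t) (at_right t)) \<and>
     (\<forall>t>0. p t \<in> subdifferential J (u t) \<and>
            (\<forall>q\<in>subdifferential J (u t). norm (p t) \<le> norm q))"

text \<open>The flow \<open>u\<close> is passed as an argument; it is determined on \<open>[0, \<infinity>)\<close> by its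
  datum \<open>f\<close>. In \<^typ>\<open>ereal\<close> the infimum of the empty set is \<open>\<infinity>\<close>.\<close>

definition extinction_time ::
  "('a::real_inner \<Rightarrow> ereal) \<Rightarrow> 'a \<Rightarrow> (real \<Rightarrow> 'a) \<Rightarrow> ereal" where
  "extinction_time J f u = Inf (ereal ` {t. t > 0 \<and> u t = proj_null J f})"

lemma class_C_nonneg:
  assumes "J \<in> class_C"
  shows "0 \<le> J u"
proof -
  have cv: "J ((1 - s) *\<^sub>R x + s *\<^sub>R y) \<le> ereal (1 - s) * J x + ereal s * J y"
    if "0 \<le> s" "s \<le> 1" for s x y
    using assms that by (auto simp: class_C_def convex_ereal_def)
  have ah: "absolutely_one_homogeneous J" using assms by (simp add: class_C_def)
  have J0: "J 0 = 0" using ah unfolding absolutely_one_homogeneous_def by blast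
  have hom: "J ((-1) *\<^sub>R u) = ereal \<bar>-1\<bar> * J u"
    using ah unfolding absolutely_one_homogeneous_def
    by (metis zero_neq_neg_one)
  have "(1 - 1/2) *\<^sub>R u + (1/2) *\<^sub>R ((-1) *\<^sub>R u) = 0" by simp
  with cv[of "1/2" u "(-1) *\<^sub>R u"] hom J0 have "0 \<le> ereal (1/2) * J u + ereal (1/2) * J u"
    by simp
  then show ?thesis by (cases "J u") auto
qed

lemma subspace_null_set:
  assumes J: "J \<in> class_C"
  shows "subspace (null_set J)"
proof -
  have cv: "J ((1 - s) *\<^sub>R x + s *\<^sub>R y) \<le> ereal (1 - s) * J x + ereal s * J y"
    if "0 \<le> s" "s \<le> 1" for s x y
    using assms that by (auto simp: class_C_def convex_ereal_def)
  have hom: "J (c *\<^sub>R u) = ereal \<bar>c\<bar> * J u" if "c \<noteq> 0" for u c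
    using that assms unfolding class_C_def absolutely_one_homogeneous_def by blast
  have J0: "J 0 = 0"
    using assms unfolding class_C_def absolutely_one_homogeneous_def by blast
  have sc: "J (c *\<^sub>R x) = 0" if "J x = 0" for c x
    using that J0 by (cases "c = 0") (auto simp: hom)
  have add: "J (x + y) = 0" if "J x = 0" "J y = 0" for x y
  proof -
    have "J ((1 - 1/2) *\<^sub>R (2 *\<^sub>R x) + (1/2) *\<^sub>R (2 *\<^sub>R y))
        \<le> ereal (1 - 1/2) * J (2 *\<^sub>R x) + ereal (1/2) * J (2 *\<^sub>R y)"
      by (rule cv) auto
    then have "J (x + y) \<le> 0" using sc[OF that(1)] sc[OF that(2)] by simp
    then show ?thesis using class_C_nonneg[OF J] by (simp add: antisym)
  qed
  show ?thesis using J0 sc add by (simp add: subspace_def null_set_def)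
qed

lemma closed_null_set:
  assumes J: "J \<in> class_C"
  shows "closed (null_set J)"
  unfolding closed_limpt
proof (intro allI impI)
  fix x assume "x islimpt null_set J"
  then have fr: "\<exists>\<^sub>F y in at x. y \<in> null_set J"
    by (simp add: islimpt_conv_frequently_at)
  have "Liminf (at x) J \<le> 0"
  proof (rule ccontr)
    assume "\<not> Liminf (at x) J \<le> 0"
    then have "\<forall>\<^sub>F y in at x. 0 < J y"
      using less_LiminfD[of 0 "at x" J] by simp
    with fr have "\<exists>\<^sub>F y in at x. 0 < J y \<and> J y = 0"
      by (auto simp: null_set_def conj_commute
          dest: frequently_eventually_frequently)
    then show False by (auto dest: frequently_ex)
  qed
  moreover have "J x \<le> Liminf (at x) J"
    using J by (auto simp: class_C_def lower_semicontinuous_def)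
  ultimately have "J x \<le> 0" by (rule order_trans[rotated])
  then show "x \<in> null_set J"
    using class_C_nonneg[OF J, of x] by (simp add: null_set_def antisym)
qed

lemma orthogonal_projection_ex1:
  fixes S :: "'a::{real_inner, complete_space} set"
  assumes S: "subspace S" "closed S"
  shows "\<exists>!x. x \<in> S \<and> (\<forall>y\<in>S. orthogonal (f - x) y)"
proof -
  define d where "d = (INF y\<in>S. (norm (f - y))\<^sup>2)"
  have S0: "0 \<in> S" using S(1) by (rule subspace_0)
  have bdd: "bdd_below ((\<lambda>y. (norm (f - y))\<^sup>2) ` S)"
    by (rule bdd_belowI[of _ 0]) auto
  have low: "d \<le> (norm (f - y))\<^sup>2" if "y \<in> S" for y
    unfolding d_def by (rule cINF_lower[OF bdd that])
  have "\<exists>y\<in>S. (norm (f - y))\<^sup>2 < d + 1 / real (Suc n)" for n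
  proof (rule ccontr)
    assume "\<not> ?thesis"
    then have "d + 1 / real (Suc n) \<le> d"
      unfolding d_def using S0 by (intro cINF_greatest) (auto simp: d_def not_less)
    then show False by (auto simp: field_simps)
  qed
  then obtain y where yS: "\<And>n. y n \<in> S"
    and yd: "\<And>n. (norm (f - y n))\<^sup>2 < d + 1 / real (Suc n)" by metis
  have par: "(norm (y m - y n))\<^sup>2 \<le> 2 / real (Suc m) + 2 / real (Suc n)" for m n
  proof -
    have "(1/2) *\<^sub>R (y m + y n) \<in> S"
      using S(1) yS by (simp add: subspace_add subspace_scale)
    from low[OF this] have "4 * d \<le> 4 * (norm (f - (1/2) *\<^sub>R (y m + y n)))\<^sup>2" by simp
    also have "\<dots> = 2 * (norm (f - y m))\<^sup>2 + 2 * (norm (f - y n))\<^sup>2 - (norm (y m - y n))\<^sup>2"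
      by (simp add: power2_norm_eq_inner inner_diff inner_add inner_commute algebra_simps)
    finally show ?thesis using yd[of m] yd[of n] by simp
  qed
  have "Cauchy y"
  proof (rule metric_CauchyI)
    fix e :: real assume e: "0 < e"
    obtain N where N: "4 / e\<^sup>2 < real N" using reals_Archimedean2 by blast
    have Np: "real N > 0" using N e by (smt (verit) divide_nonneg_nonneg zero_le_power2)
    show "\<exists>M. \<forall>m\<ge>M. \<forall>n\<ge>M. dist (y m) (y n) < e"
    proof (intro exI allI impI)
      fix m n assume mn: "N \<le> m" "N \<le> n"
      have "2 / real (Suc m) \<le> 2 / real N" "2 / real (Suc n) \<le> 2 / real N"
        using mn Np by (auto intro!: divide_left_mono)
      then have "(norm (y m - y n))\<^sup>2 \<le> 4 / real N" using par[of m n] by simp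
      also have "\<dots> < e\<^sup>2" using N Np e by (simp add: field_simps)
      finally show "dist (y m) (y n) < e"
        using e by (simp add: dist_norm power2_less_imp_less)
    qed
  qed
  then obtain x where x: "y \<longlonglongrightarrow> x" using Cauchy_convergent convergent_def by blast
  have xS: "x \<in> S" using closed_sequentially[OF S(2) yS x] .
  have "(\<lambda>n. (norm (f - y n))\<^sup>2) \<longlonglongrightarrow> (norm (f - x))\<^sup>2"
    by (intro tendsto_intros x)
  moreover have "(\<lambda>n. d + 1 / real (Suc n)) \<longlonglongrightarrow> d + 0"
    by (intro tendsto_intros LIMSEQ_Suc[OF lim_1_over_n])
  ultimately have xd: "(norm (f - x))\<^sup>2 \<le> d"
    using yd by (auto intro: LIMSEQ_le less_imp_le)
  have orth: "(f - x) \<bullet> z = 0" if z: "z \<in> S" for z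
  proof (cases "z = 0")
    case False
    define r where "r = ((f - x) \<bullet> z) / (z \<bullet> z)"
    have zz: "z \<bullet> z > 0" using False by simp
    have "x + r *\<^sub>R z \<in> S" using S(1) xS z by (simp add: subspace_add subspace_scale)
    from order_trans[OF xd low[OF this]]
    have "0 \<le> r * r * (z \<bullet> z) - 2 * r * ((f - x) \<bullet> z)"
      by (simp add: power2_norm_eq_inner inner_diff inner_add inner_commute algebra_simps)
    also have "\<dots> = - (((f - x) \<bullet> z)\<^sup>2 / (z \<bullet> z))"
      using zz by (simp add: r_def power2_eq_square field_simps)
    finally have "((f - x) \<bullet> z)\<^sup>2 / (z \<bullet> z) \<le> 0" by simp
    then have "((f - x) \<bullet> z)\<^sup>2 \<le> 0" using zz by (simp add: divide_le_0_iff)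
    then show ?thesis by simp
  qed simp
  show ?thesis
  proof (rule ex1I[of _ x])
    show "x \<in> S \<and> (\<forall>y\<in>S. orthogonal (f - x) y)" using xS orth by (simp add: orthogonal_def)
  next
    fix w assume w: "w \<in> S \<and> (\<forall>y\<in>S. orthogonal (f - w) y)"
    have m: "w - x \<in> S" using w xS S(1) by (simp add: subspace_diff)
    have "(f - w) \<bullet> (w - x) = 0" "(f - x) \<bullet> (w - x) = 0"
      using w m orth by (auto simp: orthogonal_def)
    then have "(w - x) \<bullet> (w - x) = 0" by (simp add: inner_diff_left)
    then show "w = x" by simp
  qed
qed

lemma proj_null_set:
  assumes "J \<in> class_C"
  shows "proj_null J f \<in> null_set J"
    and "y \<in> null_set J \<Longrightarrow> orthogonal (f - proj_null J f) y"
  using theI'[OF orthogonal_projection_ex1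
      [OF subspace_null_set[OF assms] closed_null_set[OF assms], of f]]
  by (simp_all add: proj_null_def orthogonal_projection_def)

end

theory Submission
  imports Defs
begin

text \<open>
  The distance \<open>w t = norm (u t - proj_null J f)\<close> reaches zero in finite time because it decreases
  at least at rate \<open>1 / C\<close> for as long as it is positive. The key point is that a subgradient
  \<open>p \<in> subdifferential J u\<close> is orthogonal to every null vector \<open>z\<close> of \<open>J\<close>, since both
  \<open>p \<bullet> z \<le> J z = 0\<close> and \<open>p \<bullet> (- z) \<le> J (- z) = 0\<close>. Hence the right derivative of \<open>w\<close> at a
  time where \<open>w\<close> does not vanish is
  \<open>- (p \<bullet> (u - proj_null J f)) / w = - (p \<bullet> u) / w = - J u / w\<close>, and the hypothesis
  \<open>w \<le> C J u\<close> makes this at most \<open>- 1 / C\<close>.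

  The flow is differentiable from the right only, so the passage from this inequality to
  \<open>w b \<le> w 0 - b / C\<close> rests on the monotonicity criterion \<open>right_derivative_nonpos_imp_le\<close>.
  If \<open>w\<close> had no zero in \<open>{0<..b}\<close> for some \<open>b > C * w 0\<close>, then \<open>w b\<close> would be negative. So every
  such \<open>b\<close> bounds a time with \<open>u t = proj_null J f\<close> from above. Taking a margin \<open>b > C * w 0\<close> also covers the case
  \<open>w 0 = 0\<close>, since the extinction time is an infimum over positive times only.
\<close>

text \<open>If \<open>k b > k a\<close>, then right of the last point with \<open>k t \<le> k a\<close> the function stays above
  \<open>k a\<close>, whereas the negative right derivative at that point forces it to go below.\<close>

lemma right_derivative_neg_imp_le:
  fixes k :: "real \<Rightarrow> real"
  assumes cont: "continuous_on {a..b} k" and ab: "a \<le> b"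
    and der: "\<And>t. a \<le> t \<Longrightarrow> t < b \<Longrightarrow> \<exists>d<0. (k has_real_derivative d) (at_right t)"
  shows "k b \<le> k a"
proof (rule ccontr)
  assume neg: "\<not> k b \<le> k a"
  define S where "S = {t \<in> {a..b}. k t \<le> k a}"
  have "closed S"
    unfolding S_def using cont by (intro continuous_on_closed_Collect_le) auto
  moreover have "bounded S"
    unfolding S_def by (rule bounded_subset[of "{a..b}"]) auto
  ultimately have "compact S" by (simp add: compact_eq_bounded_closed)
  moreover have "a \<in> S" using ab by (simp add: S_def)
  ultimately obtain s where s: "s \<in> S" and last: "\<And>t. t \<in> S \<Longrightarrow> t \<le> s"
    using compact_attains_sup[of S] by blast
  have "a \<le> s" "s < b" using s neg by (auto simp: S_def order.order_iff_strict)
  then obtain d where "d < 0" "(k has_real_derivative d) (at_right s)" using der by blast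
  then obtain e where e: "e > 0" and dec: "\<And>h. 0 < h \<Longrightarrow> h < e \<Longrightarrow> k (s + h) < k s"
    using has_real_derivative_neg_dec_right[of k d s "{s<..}"] by auto
  define h where "h = min (e / 2) (b - s)"
  have h: "0 < h" "h < e" "s + h \<le> b" using e \<open>s < b\<close> by (auto simp: h_def)
  have "k (s + h) \<le> k a" using dec[of h] h s by (simp add: S_def)
  then have "s + h \<in> S" using h \<open>a \<le> s\<close> by (simp add: S_def)
  then show False using last[of "s + h"] h by simp
qed

text \<open>Subtracting \<open>e * t\<close> with \<open>e > 0\<close> makes the right derivative strictly negative, and \<open>e\<close>
  then tends to zero.\<close>

lemma right_derivative_nonpos_imp_le:
  fixes g :: "real \<Rightarrow> real"
  assumes cont: "continuous_on {a..b} g" and ab: "a < b"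
    and der: "\<And>t. a < t \<Longrightarrow> t < b \<Longrightarrow> \<exists>d\<le>0. (g has_real_derivative d) (at_right t)"
  shows "g b \<le> g a"
proof -
  have slope: "g b \<le> g c + e * (b - c)" if c: "a < c" "c < b" and e: "e > 0" for c e
  proof -
    have "g b - e * b \<le> g c - e * c"
    proof (rule right_derivative_neg_imp_le[where k = "\<lambda>t. g t - e * t"])
      show "continuous_on {c..b} (\<lambda>t. g t - e * t)"
        using c by (intro continuous_intros continuous_on_subset[OF cont]) auto
      show "\<exists>d<0. ((\<lambda>t. g t - e * t) has_real_derivative d) (at_right t)"
        if t: "c \<le> t" "t < b" for t
      proof -
        obtain d where d: "d \<le> 0" "(g has_real_derivative d) (at_right t)"
          using der[of t] t c by auto
        have "((\<lambda>t. g t - e * t) has_real_derivative d - e) (at_right t)"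
          by (auto intro!: derivative_eq_intros d(2))
        then show ?thesis using d(1) e by (intro exI[of _ "d - e"]) auto
      qed
    qed (use c in simp)
    then show ?thesis by (simp add: algebra_simps)
  qed
  have interior: "g b \<le> g c" if c: "a < c" "c < b" for c
  proof (rule field_le_epsilon)
    fix e :: real assume "e > 0"
    then show "g b \<le> g c + e" using slope[OF c, of "e / (b - c)"] c by simp
  qed
  \<comment> \<open>No derivative is available at the left end point itself, which is reached by continuity.\<close>
  have "(g \<longlongrightarrow> g a) (at_right a)"
    using cont ab by (metis continuous_on_Icc_at_rightD)
  moreover have "\<forall>\<^sub>F c in at_right a. g b \<le> g c"
    using eventually_at_right_real[OF ab] by eventually_elim (use interior in auto)
  ultimately show ?thesis
    by (rule tendsto_lowerbound) simp
qed

lemma subgradient_orthogonal_null_set: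
  assumes J: "J \<in> class_C" and q: "q \<in> subdifferential J x" and z: "z \<in> null_set J"
  shows "q \<bullet> z = 0"
proof -
  have mz: "- z \<in> null_set J" using subspace_neg[OF subspace_null_set[OF J] z] .
  have "ereal (q \<bullet> z) \<le> J z" "ereal (q \<bullet> (- z)) \<le> J (- z)"
    using q unfolding subdifferential_def by blast+
  then show ?thesis using z mz by (simp add: null_set_def)
qed

text \<open>The chain rule gives the slope \<open>- (p t \<bullet> (u t - z)) / norm (u t - z)\<close>; the numerator equals
  \<open>J (u t)\<close> by the orthogonality of \<open>p t\<close> to \<open>z\<close> and the identity \<open>p t \<bullet> u t = J (u t)\<close>.\<close>

lemma gradient_flow_dist_right_derivative:
  assumes J: "J \<in> class_C" and flow: "gradient_flow J f u p"
    and z: "z \<in> null_set J" and t: "t > 0" and ne: "u t \<noteq> z"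
  shows "((\<lambda>s. norm (u s - z)) has_real_derivative
           - (real_of_ereal (J (u t)) / norm (u t - z))) (at_right t)"
proof -
  have pt: "p t \<in> subdifferential J (u t)"
    and der: "(u has_vector_derivative - p t) (at_right t)"
    using flow t by (auto simp: gradient_flow_def)
  have "ereal (p t \<bullet> u t) = J (u t)"
    using pt unfolding subdifferential_def by blast
  then have Ju: "p t \<bullet> (u t - z) = real_of_ereal (J (u t))"
    using subgradient_orthogonal_null_set[OF J pt z]
    by (metis inner_diff_right diff_zero real_of_ereal.simps(1))
  have "((\<lambda>s. u s - z) has_derivative (\<lambda>h. h *\<^sub>R (- p t))) (at_right t)"
    using der by (auto simp: has_vector_derivative_def intro!: derivative_eq_intros)
  moreover have "(norm has_derivative (\<lambda>h. h \<bullet> sgn (u t - z))) (at (u t - z))"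
    using ne by (intro has_derivative_norm) simp
  ultimately have "((\<lambda>s. norm (u s - z)) has_derivative
      (\<lambda>h. (h *\<^sub>R (- p t)) \<bullet> sgn (u t - z))) (at_right t)"
    by (rule has_derivative_compose)
  moreover have "(\<lambda>h. (h *\<^sub>R (- p t)) \<bullet> sgn (u t - z))
      = (*) (- (real_of_ereal (J (u t)) / norm (u t - z)))"
    by (rule ext) (simp add: sgn_div_norm Ju divide_inverse mult_ac)
  ultimately show ?thesis by (simp only: has_field_derivative_def)
qed

theorem theorem6p2:
  fixes J :: "'a::{real_inner, complete_space} \<Rightarrow> ereal"
    and f :: 'a
    and u p :: "real \<Rightarrow> 'a"
    and C :: real
  assumes "J \<in> class_C"
    and "gradient_flow J f u p"
    and "C > 0"
    and "\<And>t. t > 0 \<Longrightarrow> ereal (norm (u t - proj_null J f)) \<le> ereal C * J (u t)"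
  shows "extinction_time J f u \<le> ereal (C * norm (f - proj_null J f))"
proof -
  define z where "z = proj_null J f"
  define T where "T = C * norm (f - z)"
  have z: "z \<in> null_set J" using proj_null_set(1)[OF assms(1)] by (simp add: z_def)
  have cont: "continuous_on {0..} u" and u0: "u 0 = f"
    using assms(2) by (auto simp: gradient_flow_def)
  have hit: "\<exists>t. 0 < t \<and> t \<le> b \<and> u t = z" if b: "b > T" for b
  proof (rule ccontr)
    assume "\<not> ?thesis"
    then have ne: "u t \<noteq> z" if "0 < t" "t \<le> b" for t using that by blast
    have "0 \<le> T" using assms(3) by (simp add: T_def)
    then have "0 < b" using b by simp
    have "norm (u b - z) + b / C \<le> norm (u 0 - z) + 0 / C"
    proof (rule right_derivative_nonpos_imp_le[where g = "\<lambda>t. norm (u t - z) + t / C"])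
      show "continuous_on {0..b} (\<lambda>t. norm (u t - z) + t / C)"
        using assms(3) by (intro continuous_intros continuous_on_subset[OF cont]) auto
      show "0 < b" by fact
      show "\<exists>d\<le>0. ((\<lambda>t. norm (u t - z) + t / C) has_real_derivative d) (at_right t)"
        if t: "0 < t" "t < b" for t
      proof -
        let ?j = "real_of_ereal (J (u t))"
        \<comment> \<open>Finiteness of \<open>J (u t)\<close> turns the extended real hypothesis into a real one.\<close>
        have "u t \<in> dom_subdifferential J" using assms(2) t by (simp add: gradient_flow_def)
        then obtain q where "ereal (q \<bullet> u t) = J (u t)"
          unfolding dom_subdifferential_def subdifferential_def by blast
        then have "J (u t) = ereal ?j" by (metis real_of_ereal.simps(1))
        then have "ereal (norm (u t - z)) \<le> ereal C * ereal ?j"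
          using assms(4)[OF t(1)] by (simp add: z_def)
        then have bound: "norm (u t - z) \<le> C * ?j" by simp
        have "((\<lambda>t. norm (u t - z) + t / C) has_real_derivative
            - (?j / norm (u t - z)) + 1 / C) (at_right t)"
          using ne[of t] t assms(3)
          by (auto intro!: derivative_eq_intros
              gradient_flow_dist_right_derivative[OF assms(1,2) z])
        moreover have "- (?j / norm (u t - z)) + 1 / C \<le> 0"
          using bound ne[of t] t assms(3) by (simp add: field_simps)
        ultimately show ?thesis by blast
      qed
    qed
    then have "b / C \<le> norm (f - z)" using norm_ge_zero[of "u b - z"] unfolding u0 by linarith
    then show False using b assms(3) by (simp add: T_def field_simps)
  qed
  have "extinction_time J f u \<le> ereal T"
  proof (rule ereal_le_epsilon2)
    fix e :: real assume "e > 0"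
    then obtain t where t: "0 < t" "t \<le> T + e" "u t = z" using hit[of "T + e"] by auto
    have "extinction_time J f u \<le> ereal t"
      unfolding extinction_time_def using t by (intro Inf_lower) (auto simp: z_def)
    also have "\<dots> \<le> ereal T + ereal e" using t by simp
    finally show "extinction_time J f u \<le> ereal T + ereal e" .
  qed
  then show ?thesis by (simp add: T_def z_def)
qed

end
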